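(* Every closed subspace of a ray space is itself (homeomorphic to) a ray space: if $T$ is a tree and $Y\subseteq\mathcal{R}(T)$ is closed, then there is a tree $T'$ such that $Y$ is homeomorphic to $\mathcal{R}(T')$.
   Context: A tree is a partially ordered set $T$ with a unique minimal element such that the set of predecessors of any element is well-ordered (distinct limit nodes may have the same set of strict predecessors). A path in $T$ is a nonempty down-closed chain; a ray is a path without maximal element. The ray space $\mathcal{R}(T)$ is the set of all rays of $T$ with the subspace topology inherited from $2^T$ (product topology), rays being identified with their characteristic functions. *)

theory Defs
  imports "HOL-Analysis.Analysis"
begin

text \<open>Trees are given by a carrier set and a reflexive order relation on it. Only the sets of
  predecessors are required to be well-ordered, so distinct limit nodes may have the same strict
  predecessors.\<close>

definition tree_on :: "'a set \<Rightarrow> 'a rel \<Rightarrow> bool" where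
  "tree_on T r \<longleftrightarrow>
     partial_order_on T r \<and>
     (\<exists>!x. x \<in> T \<and> (\<forall>y\<in>T. (y, x) \<in> r \<longrightarrow> y = x)) \<and>
     (\<forall>t\<in>T. well_order_on (underS r t) (Restr r (underS r t)))"

definition tree_path :: "'a set \<Rightarrow> 'a rel \<Rightarrow> 'a set \<Rightarrow> bool" where
  "tree_path T r P \<longleftrightarrow>
     P \<noteq> {} \<and> P \<subseteq> T \<and> P \<in> Chains r \<and> (\<forall>t\<in>P. under r t \<subseteq> P)"

definition tree_ray :: "'a set \<Rightarrow> 'a rel \<Rightarrow> 'a set \<Rightarrow> bool" where
  "tree_ray T r P \<longleftrightarrow>
     tree_path T r P \<and> \<not> (\<exists>m\<in>P. \<forall>t\<in>P. (m, t) \<in> r \<longrightarrow> t = m)"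

text \<open>The points of the product space of \<open>T\<close> copies of \<open>bool\<close> are functions that are
  \<open>undefined\<close> outside \<open>T\<close>, hence the restricted characteristic function.\<close>

definition char_fun :: "'a set \<Rightarrow> 'a set \<Rightarrow> ('a \<Rightarrow> bool)" where
  "char_fun T P = (\<lambda>t\<in>T. t \<in> P)"

definition ray_space :: "'a set \<Rightarrow> 'a rel \<Rightarrow> ('a \<Rightarrow> bool) topology" where
  "ray_space T r =
     subtopology (product_topology (\<lambda>_. discrete_topology (UNIV :: bool set)) T)
                 (char_fun T ` {P. tree_ray T r P})"

end

theory Submission
  imports Defs
begin

text \<open>For a set \<open>Z\<close> of rays let \<open>Z\<^sub>t\<close> be the set of members of \<open>Z\<close> that contain \<open>t\<close>. The nonempty
  sets \<open>Z\<^sub>t\<close> together with \<open>Z\<close> form a tree under reverse inclusion, and a ray \<open>y \<in> Z\<close> yields the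
  down-closed chain of those sets that contain \<open>y\<close>. This chain may have a maximal element \<open>b\<close>;
  in that case \<open>b\<close> determines \<open>y\<close>, and replacing \<open>b\<close> by a copy of the natural numbers turns the
  chain into a ray without introducing any further clopen sets. When \<open>Z\<close> is closed no other rays
  arise: if \<open>P \<notin> Z\<close> is a ray, a basic neighbourhood of \<open>P\<close> that misses \<open>Z\<close> forces \<open>Z\<^sub>u\<close> to be
  constant for all sufficiently large \<open>u \<in> P\<close>, so the sets \<open>Z\<^sub>u\<close> do not form a chain without a
  maximal element.\<close>

section \<open>Least elements in trees and rays\<close>

text \<open>Least elements of nonempty sets contain the whole well-ordering: two-element sets give
  totality, and intersecting with \<open>underS r t\<close> gives well-foundedness. For the cone
  tree this is the easier condition to check.\<close>

lemma tree_onI: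
  assumes po: "partial_order_on T r"
    and root: "x \<in> T" "\<And>y. y \<in> T \<Longrightarrow> (x, y) \<in> r"
    and least: "\<And>t A. \<lbrakk>t \<in> T; A \<subseteq> under r t; A \<noteq> {}\<rbrakk> \<Longrightarrow> \<exists>a\<in>A. \<forall>b\<in>A. (a, b) \<in> r"
  shows "tree_on T r"
  unfolding tree_on_def
proof (intro conjI ballI)
  note ord = partial_order_onD[OF po]
  show "partial_order_on T r" by (fact po)
  show "\<exists>!x. x \<in> T \<and> (\<forall>y\<in>T. (y, x) \<in> r \<longrightarrow> y = x)"
  proof (rule ex1I[of _ x])
    show "x \<in> T \<and> (\<forall>y\<in>T. (y, x) \<in> r \<longrightarrow> y = x)"
      using root ord(3) by (meson antisymD)
  qed (use root in blast)
  fix t assume t: "t \<in> T"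
  let ?U = "underS r t"
  have sub: "?U \<subseteq> under r t" "?U \<subseteq> T"
    using ord(4) by (auto simp: underS_def under_def)
  have min: "\<exists>a\<in>A. \<forall>b\<in>A. (a, b) \<in> r" if "A \<subseteq> ?U" "A \<noteq> {}" for A
    using least[OF t, of A] that sub by blast
  have "total_on ?U (Restr r ?U)"
  proof (rule total_onI)
    fix a b assume "a \<in> ?U" "b \<in> ?U"
    then show "(a, b) \<in> Restr r ?U \<or> (b, a) \<in> Restr r ?U"
      using min[of "{a, b}"] by auto
  qed
  moreover have "refl_on ?U (Restr r ?U)"
    using ord(1) sub(2) by (auto simp: refl_on_def)
  moreover have "trans (Restr r ?U)"
    using ord(2) by (auto intro!: transI dest: transD)
  moreover have "antisym (Restr r ?U)"
    using ord(3) by (auto intro!: antisymI dest: antisymD)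
  moreover have "wf (Restr r ?U - Id)"
    unfolding wf_eq_minimal
  proof (intro allI impI)
    fix Q and q :: 'a assume "q \<in> Q"
    show "\<exists>z\<in>Q. \<forall>y. (y, z) \<in> Restr r ?U - Id \<longrightarrow> y \<notin> Q"
    proof (cases "Q \<inter> ?U = {}")
      case True
      then show ?thesis using \<open>q \<in> Q\<close> by blast
    next
      case False
      then obtain a where "a \<in> Q \<inter> ?U" "\<forall>b\<in>Q \<inter> ?U. (a, b) \<in> r"
        using min[of "Q \<inter> ?U"] by blast
      then show ?thesis
        using ord(3) by (intro bexI[of _ a]) (auto dest: antisymD)
    qed
  qed
  ultimately show "well_order_on ?U (Restr r ?U)"
    by (auto simp: order_on_defs)
qed

text \<open>Putting \<open>t\<close> on top of its strict predecessors preserves least elements: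
  either \<open>A\<close> is just \<open>{t}\<close>, or the minimum of \<open>A\<close> among the
  strict predecessors also lies below \<open>t\<close>.\<close>

lemma tree_on_under_least:
  assumes "tree_on T r" "t \<in> T" "A \<subseteq> under r t" "A \<noteq> {}"
  obtains a where "a \<in> A" "\<And>b. b \<in> A \<Longrightarrow> (a, b) \<in> r"
proof (cases "A \<inter> underS r t = {}")
  case True
  with assms(3,4) have "A = {t}"
    by (auto simp: underS_def under_def)
  moreover have "(t, t) \<in> r"
    using assms(1,2) by (auto simp: tree_on_def order_on_defs refl_on_def)
  ultimately show ?thesis using that by blast
next
  case False
  let ?U = "underS r t"
  have wo: "well_order_on ?U (Restr r ?U)"
    using assms(1,2) by (auto simp: tree_on_def)
  from False obtain q where "q \<in> A \<inter> ?U" by blast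
  with wo obtain a where a: "a \<in> A \<inter> ?U"
    and min: "\<And>b. (b, a) \<in> Restr r ?U - Id \<Longrightarrow> b \<notin> A \<inter> ?U"
    unfolding well_order_on_def by (metis wfE_min)
  have "(a, b) \<in> r" if "b \<in> A" for b
  proof (cases "b = t")
    case True
    then show ?thesis using a by (auto simp: underS_def)
  next
    case False
    then have b: "b \<in> A \<inter> ?U"
      using that assms(3) by (auto simp: underS_def under_def)
    show ?thesis
      using wo a b min[of b]
      by (cases "a = b") (auto simp: order_on_defs refl_on_def total_on_def)
  qed
  then show ?thesis using that a by blast
qed

lemma tree_rayD:
  assumes "tree_ray T r P"
  shows "P \<noteq> {}" "P \<subseteq> T"
    and "\<And>s t. \<lbrakk>s \<in> P; t \<in> P\<rbrakk> \<Longrightarrow> (s, t) \<in> r \<or> (t, s) \<in> r"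
    and "\<And>s t. \<lbrakk>t \<in> P; (s, t) \<in> r\<rbrakk> \<Longrightarrow> s \<in> P"
    and "\<And>m. m \<in> P \<Longrightarrow> \<exists>t\<in>P. (m, t) \<in> r \<and> t \<noteq> m"
  using assms by (auto simp: tree_ray_def tree_path_def Chains_def under_def)

lemma tree_rayI:
  assumes "P \<noteq> {}" "P \<subseteq> T"
    and "\<And>s t. \<lbrakk>s \<in> P; t \<in> P\<rbrakk> \<Longrightarrow> (s, t) \<in> r \<or> (t, s) \<in> r"
    and "\<And>s t. \<lbrakk>t \<in> P; (s, t) \<in> r\<rbrakk> \<Longrightarrow> s \<in> P"
    and "\<And>m. m \<in> P \<Longrightarrow> \<exists>t\<in>P. (m, t) \<in> r \<and> t \<noteq> m"
  shows "tree_ray T r P"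
  using assms by (fastforce simp: tree_ray_def tree_path_def Chains_def under_def)

text \<open>A ray need not lie below a single node, but it is a chain: for any \<open>t\<close> in
  \<open>A\<close>, the least element of the part of \<open>A\<close> up to \<open>t\<close> is also
  below everything beyond \<open>t\<close>.\<close>

lemma tree_ray_least:
  assumes "tree_on T r" "tree_ray T r P" "A \<subseteq> P" "A \<noteq> {}"
  obtains a where "a \<in> A" "\<And>b. b \<in> A \<Longrightarrow> (a, b) \<in> r"
proof -
  note P = tree_rayD[OF assms(2)]
  have ord: "trans r" "refl_on T r"
    using assms(1) by (auto simp: tree_on_def order_on_defs)
  from assms(4) obtain t where t: "t \<in> A" by blast
  have tT: "t \<in> T" using t assms(3) P(2) by blast
  have "A \<inter> under r t \<noteq> {}"
    using t tT ord(2) by (auto simp: under_def refl_on_def)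
  then obtain a where a: "a \<in> A \<inter> under r t" "\<And>b. b \<in> A \<inter> under r t \<Longrightarrow> (a, b) \<in> r"
    using tree_on_under_least[OF assms(1) tT, of "A \<inter> under r t"] by blast
  have "(a, b) \<in> r" if "b \<in> A" for b
  proof (cases "(b, t) \<in> r")
    case True
    then show ?thesis using a that by (auto simp: under_def)
  next
    case False
    then have "(t, b) \<in> r" using P(3)[of b t] that t assms(3) by blast
    then show ?thesis using a(1) ord(1) by (auto simp: under_def dest: transD)
  qed
  then show ?thesis using that a(1) by blast
qed

section \<open>The tree of cones of a closed set of rays\<close>

text \<open>Topological closedness spelled out on rays as sets: \<open>F\<close> holds the finitely
  many coordinates fixed by a basic neighbourhood of \<open>P\<close> that misses
  \<open>Z\<close>.\<close>

locale closed_ray_set =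
  fixes T :: "'a set" and r :: "'a rel" and Z :: "'a set set"
  assumes tree: "tree_on T r"
    and rays: "\<And>P. P \<in> Z \<Longrightarrow> tree_ray T r P"
    and closed: "\<And>P. \<lbrakk>tree_ray T r P; P \<notin> Z\<rbrakk> \<Longrightarrow>
      \<exists>F\<subseteq>T. finite F \<and> (\<forall>Q\<in>Z. \<exists>s\<in>F. s \<in> P \<longleftrightarrow> s \<notin> Q)"
begin

definition ray_cone :: "'a \<Rightarrow> 'a set set" where
  "ray_cone t = {Q \<in> Z. t \<in> Q}"

text \<open>\<open>Z\<close> is inserted by hand so that a root exists even when \<open>Z\<close> is
  empty.\<close>

definition cones :: "'a set set set" where
  "cones = insert Z {ray_cone t | t. t \<in> T \<and> ray_cone t \<noteq> {}}"

text \<open>The chain of cones through some \<open>y\<close> ends at \<open>b\<close>. Such a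
  \<open>b\<close> need not be a singleton: its other members are rays properly extending
  \<open>y\<close>.\<close>

definition extended :: "'a set set \<Rightarrow> bool" where
  "extended b \<longleftrightarrow> (\<exists>y\<in>b. \<forall>c\<in>cones. y \<in> c \<longrightarrow> b \<subseteq> c)"

definition cone_tree :: "('a set set \<times> nat) set" where
  "cone_tree = {(b, n). b \<in> cones \<and> (n = 0 \<or> extended b)}"

text \<open>Lexicographic, with reverse inclusion first: all copies of a cone come before every
  strictly smaller cone.\<close>

definition cone_order :: "('a set set \<times> nat) rel" where
  "cone_order = {((b, n), (c, m)). (b, n) \<in> cone_tree \<and> (c, m) \<in> cone_tree \<and>
     (c \<subset> b \<or> b = c \<and> n \<le> m)}"

definition cone_ray :: "'a set \<Rightarrow> ('a set set \<times> nat) set" where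
  "cone_ray y = {(b, n) \<in> cone_tree. y \<in> b}"

lemma trans_r: "(s, t) \<in> r \<Longrightarrow> (t, u) \<in> r \<Longrightarrow> (s, u) \<in> r"
  and antisym_r: "(s, t) \<in> r \<Longrightarrow> (t, s) \<in> r \<Longrightarrow> s = t"
  and r_carrier: "(s, t) \<in> r \<Longrightarrow> s \<in> T \<and> t \<in> T"
  using tree by (auto simp: tree_on_def order_on_defs dest: transD antisymD)

lemma ray_cone_mono: "(s, t) \<in> r \<Longrightarrow> ray_cone t \<subseteq> ray_cone s"
  using tree_rayD(4)[OF rays] by (auto simp: ray_cone_def)

lemma cones_cases:
  assumes "b \<in> cones"
  obtains "b = Z" | t where "t \<in> T" "b = ray_cone t" "b \<noteq> {}"
  using assms by (auto simp: cones_def)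

lemma cones_subset: "b \<in> cones \<Longrightarrow> b \<subseteq> Z"
  by (auto simp: cones_def ray_cone_def)

text \<open>Well-ordering is transferred from the ray \<open>y\<close>. Cones through
  \<open>y\<close> other than \<open>Z\<close> are \<open>ray_cone t\<close> with \<open>t\<close>
  on \<open>y\<close>, and \<open>ray_cone\<close> reverses the order, so the least such node yields
  the greatest cone.\<close>

lemma cones_greatest_at:
  assumes "A \<subseteq> cones" "A \<noteq> {}" "\<And>c. c \<in> A \<Longrightarrow> y \<in> c"
  obtains a where "a \<in> A" "\<And>c. c \<in> A \<Longrightarrow> c \<subseteq> a"
proof (cases "Z \<in> A")
  case True
  then show ?thesis using that cones_subset assms(1) by blast
next
  case False
  have yZ: "y \<in> Z" using assms cones_subset by blast
  have A: "\<exists>t\<in>y. c = ray_cone t" if "c \<in> A" for c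
    using that False assms(1) assms(3)[OF that] by (auto simp: cones_def ray_cone_def)
  let ?S = "{t \<in> y. ray_cone t \<in> A}"
  have "?S \<subseteq> y" "?S \<noteq> {}" using A assms(2) by blast+
  then obtain t where t: "t \<in> ?S" and min: "\<And>s. s \<in> ?S \<Longrightarrow> (t, s) \<in> r"
    by (rule tree_ray_least[OF tree rays[OF yZ]]) (rule that)
  have "c \<subseteq> ray_cone t" if "c \<in> A" for c
  proof -
    obtain s where "s \<in> y" "c = ray_cone s" using A[OF \<open>c \<in> A\<close>] by blast
    then show ?thesis using min[of s] ray_cone_mono[of t s] \<open>c \<in> A\<close> by simp
  qed
  with t show ?thesis by (intro that[of "ray_cone t"]) simp_all
qed

lemma cones_greatest:
  assumes "b \<in> cones" "A \<subseteq> cones" "A \<noteq> {}" "\<And>c. c \<in> A \<Longrightarrow> b \<subseteq> c"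
  obtains a where "a \<in> A" "\<And>c. c \<in> A \<Longrightarrow> c \<subseteq> a"
proof (cases "b = {}")
  \<comment> \<open>The empty set is a cone only if \<open>Z\<close> itself is empty, and then it is
    the only cone.\<close>
  case True
  then have "Z = {}" using assms(1) by (auto simp: cones_def)
  then have "cones = {{}}" unfolding cones_def ray_cone_def by auto
  then show ?thesis using assms(2,3) that by blast
next
  case False
  then obtain y where "y \<in> b" by blast
  then show ?thesis
    using cones_greatest_at[OF assms(2,3), of y] assms(4) that by blast
qed

lemma cones_comparable:
  assumes "b \<in> cones" "c \<in> cones" "y \<in> b" "y \<in> c"
  shows "b \<subseteq> c \<or> c \<subseteq> b"
  using cones_greatest_at[of "{b, c}" y] assms by blast

lemma cone_order_iff:
  "((b, n), (c, m)) \<in> cone_order \<longleftrightarrow>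
     (b, n) \<in> cone_tree \<and> (c, m) \<in> cone_tree \<and> (c \<subset> b \<or> b = c \<and> n \<le> m)"
  by (simp add: cone_order_def)

lemma cone_tree_iff: "(b, n) \<in> cone_tree \<longleftrightarrow> b \<in> cones \<and> (n = 0 \<or> extended b)"
  by (simp add: cone_tree_def)

lemma cone_order_subset: "((b, n), (c, m)) \<in> cone_order \<Longrightarrow> c \<subseteq> b"
  by (auto simp: cone_order_iff)

lemma tree_cone_tree: "tree_on cone_tree cone_order"
proof (rule tree_onI[of _ _ "(Z, 0)"])
  have "trans cone_order"
    by (rule transI) (auto simp: cone_order_def)
  moreover have "antisym cone_order"
    by (rule antisymI) (auto simp: cone_order_def)
  moreover have "refl_on cone_tree cone_order"
    by (auto simp: cone_order_def refl_on_def)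
  ultimately show "partial_order_on cone_tree cone_order"
    by (auto simp: order_on_defs cone_order_def)
  show root: "(Z, 0) \<in> cone_tree" by (simp add: cone_tree_def cones_def)
  show "((Z, 0), p) \<in> cone_order" if "p \<in> cone_tree" for p
  proof (cases p)
    case (Pair b n)
    then show ?thesis
      using that root cones_subset[of b] by (auto simp: cone_order_iff cone_tree_iff)
  qed
next
  fix t A assume t: "t \<in> cone_tree" and A: "A \<subseteq> under cone_order t" "A \<noteq> {}"
  obtain b n where bn: "t = (b, n)" by (cases t)
  have AT: "A \<subseteq> cone_tree"
    using A(1) by (auto simp: under_def cone_order_def)
  have "b \<in> cones" using t bn by (simp add: cone_tree_iff)
  moreover have "fst ` A \<subseteq> cones" using AT by (auto simp: cone_tree_def)
  moreover have "b \<subseteq> c" if "c \<in> fst ` A" for c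
    using that A(1) bn by (auto simp: under_def cone_order_def)
  ultimately obtain c where c: "c \<in> fst ` A" "\<And>d. d \<in> fst ` A \<Longrightarrow> d \<subseteq> c"
    using cones_greatest[of b "fst ` A"] A(2) by blast
  \<comment> \<open>The least element for the lexicographic order: the greatest cone
    \<open>c\<close> first, then its lowest copy in \<open>A\<close>.\<close>
  define k where "k = (LEAST k. (c, k) \<in> A)"
  have k: "(c, k) \<in> A" "\<And>m. (c, m) \<in> A \<Longrightarrow> k \<le> m"
    using c(1) unfolding k_def by (auto intro: LeastI Least_le)
  show "\<exists>a\<in>A. \<forall>b\<in>A. (a, b) \<in> cone_order"
  proof (intro bexI ballI)
    fix p assume p: "p \<in> A"
    obtain d m where dm: "p = (d, m)" by (cases p)
    then have "d \<subseteq> c" using c(2) p by force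
    then show "((c, k), p) \<in> cone_order"
      using p dm k AT by (auto simp: cone_order_iff)
  qed (fact k(1))
qed

text \<open>With \<open>F\<close> from \<open>closed\<close>, the finitely many \<open>s \<in> F - P\<close> that do not lie above all of \<open>P\<close> are incompatible with
  some element of \<open>P\<close>; the other ones have cones contained in every \<open>ray_cone v\<close> with \<open>v \<in> P\<close>.\<close>

lemma ray_cone_stabilises:
  assumes P: "tree_ray T r P" "P \<notin> Z"
  obtains u where "u \<in> P" "\<And>v. v \<in> P \<Longrightarrow> ray_cone u \<subseteq> ray_cone v"
proof -
  note P' = tree_rayD[OF P(1)]
  obtain F where F: "finite F" "\<And>Q. Q \<in> Z \<Longrightarrow> \<exists>s\<in>F. s \<in> P \<longleftrightarrow> s \<notin> Q"
    using closed[OF P] by blast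
  have "\<exists>u\<in>P. if s \<in> P then u = s else ray_cone s \<inter> ray_cone u = {} \<or> (\<forall>v\<in>P. (v, s) \<in> r)" for s
  proof (cases "s \<in> P \<or> (\<forall>v\<in>P. (v, s) \<in> r)")
    case True
    then show ?thesis using P'(1) by auto
  next
    case False
    then obtain v where v: "v \<in> P" "(v, s) \<notin> r" "s \<notin> P" by blast
    have "Q \<notin> ray_cone v" if "Q \<in> ray_cone s" for Q
      using that v P'(4)[OF v(1), of s] tree_rayD(3)[OF rays, of Q s v] by (auto simp: ray_cone_def)
    then show ?thesis using v by auto
  qed
  then obtain w where wP: "\<And>s. w s \<in> P"
    and w: "\<And>s. if s \<in> P then w s = s else ray_cone s \<inter> ray_cone (w s) = {} \<or> (\<forall>v\<in>P. (v, s) \<in> r)"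
    by metis
  \<comment> \<open>Finite subsets of the chain \<open>P\<close> are bounded in \<open>P\<close>, so
    one \<open>u\<close> can serve all \<open>s\<close> in \<open>F\<close> at once.\<close>
  have "\<exists>u\<in>P. \<forall>x\<in>G. (x, u) \<in> r" if "finite G" "G \<subseteq> P" for G
    using that
  proof (induction G rule: finite_induct)
    case empty
    then show ?case using P'(1) by blast
  next
    case (insert x G)
    then obtain u where u: "u \<in> P" "\<forall>y\<in>G. (y, u) \<in> r" by blast
    have "(x, x) \<in> r" using P'(3)[of x x] insert.prems by blast
    then show ?case
      using P'(3)[of x u] u insert.prems by (metis insert_iff insert_subset trans_r)
  qed
  from this[of "w ` F"] obtain u where u: "u \<in> P" "\<And>s. s \<in> F \<Longrightarrow> (w s, u) \<in> r"
    using F(1) wP by blast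
  have "Q \<in> ray_cone v" if Q: "Q \<in> ray_cone u" and v: "v \<in> P" for Q v
  proof -
    have QZ: "Q \<in> Z" using Q by (simp add: ray_cone_def)
    \<comment> \<open>\<open>Q\<close> and \<open>P\<close> disagree at \<open>s\<close>. If
      \<open>s\<close> were in \<open>P\<close>, then \<open>w s = s\<close> would put
      \<open>s\<close> in \<open>Q\<close>. Otherwise \<open>Q\<close> lies in both cones at
      \<open>s\<close> and \<open>w s\<close>, so the disjoint alternative fails and
      \<open>s\<close> is above \<open>v\<close>.\<close>
    then obtain s where s: "s \<in> F" "s \<in> P \<longleftrightarrow> s \<notin> Q" using F(2) by blast
    have Qw: "Q \<in> ray_cone (w s)" using Q ray_cone_mono[OF u(2)[OF s(1)]] by blast
    show ?thesis
    proof (cases "s \<in> P")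
      case True
      then show ?thesis using w[of s] Qw s by (auto simp: ray_cone_def)
    next
      case False
      then have "Q \<in> ray_cone s" using s QZ by (simp add: ray_cone_def)
      moreover from this have "(v, s) \<in> r" using w[of s] Qw False v by auto
      ultimately show ?thesis using ray_cone_mono by blast
    qed
  qed
  then show ?thesis using that u(1) by blast
qed

section \<open>Rays of the cone tree\<close>

lemma mem_cone_ray_iff: "(b, n) \<in> cone_ray y \<longleftrightarrow> (b, n) \<in> cone_tree \<and> y \<in> b"
  by (simp add: cone_ray_def)

lemma tree_ray_cone_ray:
  assumes y: "y \<in> Z"
  shows "tree_ray cone_tree cone_order (cone_ray y)"
proof (rule tree_rayI)
  have "(Z, 0) \<in> cone_ray y"
    using y by (simp add: cone_ray_def cone_tree_def cones_def)
  then show "cone_ray y \<noteq> {}" by blast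
  show "cone_ray y \<subseteq> cone_tree" by (auto simp: cone_ray_def)
next
  fix p q assume "p \<in> cone_ray y" "q \<in> cone_ray y"
  then show "(p, q) \<in> cone_order \<or> (q, p) \<in> cone_order"
    using cones_comparable[of "fst p" "fst q" y]
    by (cases p; cases q) (auto simp: mem_cone_ray_iff cone_order_iff cone_tree_iff)
next
  fix p q assume "p \<in> cone_ray y" "(q, p) \<in> cone_order"
  then show "q \<in> cone_ray y"
    by (cases p; cases q) (auto simp: mem_cone_ray_iff cone_order_iff)
next
  fix p assume p: "p \<in> cone_ray y"
  obtain b n where bn: "p = (b, n)" by (cases p)
  have b: "b \<in> cones" "y \<in> b" "(b, n) \<in> cone_tree"
    using p bn by (auto simp: cone_ray_def cone_tree_def)
  show "\<exists>q\<in>cone_ray y. (p, q) \<in> cone_order \<and> q \<noteq> p"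
  \<comment> \<open>If \<open>b\<close> is the last cone through \<open>y\<close>, it is extended
    and its next copy is a larger element; otherwise a strictly smaller cone through
    \<open>y\<close> is.\<close>
  proof (cases "\<forall>c\<in>cones. y \<in> c \<longrightarrow> b \<subseteq> c")
    case True
    then have "(b, Suc n) \<in> cone_tree" using b by (auto simp: cone_tree_iff extended_def)
    then show ?thesis
      using b bn by (intro bexI[of _ "(b, Suc n)"]) (auto simp: cone_order_iff mem_cone_ray_iff)
  next
    case False
    then obtain c where c: "c \<in> cones" "y \<in> c" "\<not> b \<subseteq> c" by blast
    then have "c \<subset> b" using cones_comparable[of b c y] b by blast
    then show ?thesis
      using b bn c
      by (intro bexI[of _ "(c, 0)"]) (auto simp: cone_order_iff mem_cone_ray_iff cone_tree_iff)
  qed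
qed

text \<open>If the cones on \<open>C\<close> have a smallest member \<open>b\<close>, then
  \<open>C\<close> runs through all copies of \<open>b\<close>, and the ray whose chain ends at
  \<open>b\<close> induces it. If not, the nodes whose cones occur on \<open>C\<close> form a ray of
  \<open>T\<close>, which lies in \<open>Z\<close> by \<open>ray_cone_stabilises\<close>.\<close>

lemma cone_tree_ray_cases:
  assumes C: "tree_ray cone_tree cone_order C"
  shows "C \<in> cone_ray ` Z"
proof -
  note C' = tree_rayD[OF C]
  have down: "(b, n) \<in> C" if "(c, m) \<in> C" "(b, n) \<in> cone_tree" "c \<subset> b \<or> b = c \<and> n \<le> m"
    for b c n m
  proof -
    have "((b, n), (c, m)) \<in> cone_order"
      using that C'(2) unfolding cone_order_iff by blast
    then show ?thesis by (rule C'(4)[OF that(1)])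
  qed
  have comparable: "b \<subseteq> c \<or> c \<subseteq> b" if "(b, n) \<in> C" "(c, m) \<in> C" for b c n m
    using C'(3)[OF that] cone_order_subset by blast
  have zero: "(b, 0) \<in> C" if "(b, n) \<in> C" for b n
    using down[OF that] that C'(2) by (auto simp: cone_tree_iff)
  show ?thesis
  proof (cases "\<exists>b n. (b, n) \<in> C \<and> (\<forall>c m. (c, m) \<in> C \<longrightarrow> b \<subseteq> c)")
    case True
    then obtain b n where b: "(b, n) \<in> C" "\<And>c m. (c, m) \<in> C \<Longrightarrow> b \<subseteq> c" by blast
    have step: "\<exists>k>m. (b, k) \<in> C" if m: "(b, m) \<in> C" for m
    proof -
      obtain c k where "(c, k) \<in> C" "((b, m), (c, k)) \<in> cone_order" "(c, k) \<noteq> (b, m)"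
        using C'(5)[OF m] by auto
      then have "b = c" "m < k" using b(2)[of c k] by (auto simp: cone_order_iff)
      then show ?thesis using \<open>(c, k) \<in> C\<close> by blast
    qed
    have bC: "b \<in> cones" using b(1) C'(2) by (auto simp: cone_tree_iff)
    \<comment> \<open>\<open>C\<close> has no maximal element, so it contains a copy of
      \<open>b\<close> with positive index, and only extended cones have one.\<close>
    have ext: "extended b"
      using step[OF zero[OF b(1)]] C'(2) by (auto simp: cone_tree_iff)
    have all: "(b, m) \<in> C" for m
    proof (induction m)
      case 0
      then show ?case using zero b(1) by blast
    next
      case (Suc m)
      then obtain k where "k > m" "(b, k) \<in> C" using step by blast
      then show ?case using down[of b k b "Suc m"] bC ext by (auto simp: cone_tree_iff)
    qed
    obtain y where y: "y \<in> b" "\<And>c. c \<in> cones \<Longrightarrow> y \<in> c \<Longrightarrow> b \<subseteq> c"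
      using ext by (auto simp: extended_def)
    have "C = cone_ray y"
    proof (intro set_eqI iffI)
      fix p assume "p \<in> C"
      then show "p \<in> cone_ray y"
        using b(2) y(1) C'(2) by (cases p) (auto simp: mem_cone_ray_iff)
    next
      fix p assume "p \<in> cone_ray y"
      then obtain c m where p: "p = (c, m)" "(c, m) \<in> cone_tree" "y \<in> c"
        by (auto simp: cone_ray_def)
      then have "b \<subseteq> c" using y(2) by (auto simp: cone_tree_iff)
      then show "p \<in> C" using down[OF all p(2)] p(1) by blast
    qed
    then show ?thesis using y(1) cones_subset[OF bC] by blast
  next
    case False
    \<comment> \<open>A cone strictly inside \<open>b\<close> cannot be \<open>Z\<close>, so it
      comes from a node and is nonempty.\<close>
    have smaller: "\<exists>t m. (ray_cone t, m) \<in> C \<and> t \<in> T \<and> ray_cone t \<noteq> {} \<and> ray_cone t \<subset> b"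
      if "(b, n) \<in> C" for b n
    proof -
      from False that obtain c m where c: "(c, m) \<in> C" "\<not> b \<subseteq> c" by blast
      then have sub: "c \<subset> b" using comparable[OF that c(1)] by blast
      have cb: "c \<in> cones" "b \<in> cones" using c that C'(2) by (auto simp: cone_tree_iff)
      from cb(1) show ?thesis
      proof (cases rule: cones_cases)
        case 1
        then show ?thesis using sub cones_subset[OF cb(2)] by blast
      next
        case (2 t)
        then show ?thesis using c(1) sub by blast
      qed
    qed
    define P where "P = {t \<in> T. ray_cone t \<noteq> {} \<and> (ray_cone t, 0) \<in> C}"
    have above: "\<exists>t\<in>P. ray_cone t \<subset> b" if "(b, n) \<in> C" for b n
      using smaller[OF that] zero unfolding P_def by blast
    \<comment> \<open>Nested nonempty cones share a ray, which passes through both nodes.\<close>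
    have chain: "(s, t) \<in> r \<or> (t, s) \<in> r" if st: "s \<in> P" "t \<in> P" for s t
    proof -
      have "ray_cone s \<subseteq> ray_cone t \<or> ray_cone t \<subseteq> ray_cone s"
        using st comparable unfolding P_def by blast
      then obtain Q where "Q \<in> Z" "s \<in> Q" "t \<in> Q"
        using st unfolding P_def ray_cone_def by blast
      then show ?thesis using tree_rayD(3)[OF rays] by blast
    qed
    have "tree_ray T r P"
    proof (rule tree_rayI)
      show "P \<noteq> {}" using C'(1) above by fastforce
      show "P \<subseteq> T" by (auto simp: P_def)
    next
      fix s t assume "t \<in> P" "(s, t) \<in> r"
      moreover from this have "ray_cone t \<subseteq> ray_cone s" "s \<in> T" "ray_cone t \<noteq> {}"
        using ray_cone_mono r_carrier by (auto simp: P_def)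
      moreover from this have "(ray_cone s, 0) \<in> cone_tree"
        by (auto simp: cone_tree_iff cones_def)
      ultimately show "s \<in> P"
        using down[of "ray_cone t" 0 "ray_cone s" 0] by (auto simp: P_def)
    next
      fix t assume t: "t \<in> P"
      then obtain s where s: "s \<in> P" "ray_cone s \<subset> ray_cone t"
        using above[of "ray_cone t" 0] unfolding P_def by blast
      then show "\<exists>s\<in>P. (t, s) \<in> r \<and> s \<noteq> t"
        using chain[OF t s(1)] ray_cone_mono[of s t] by blast
    qed (fact chain)
    \<comment> \<open>Were \<open>P\<close> outside \<open>Z\<close>, some \<open>u\<close> in
      \<open>P\<close> would have the smallest cone, contradicting \<open>above\<close>. This is
      where closedness enters.\<close>
    moreover have False if "u \<in> P" "\<And>v. v \<in> P \<Longrightarrow> ray_cone u \<subseteq> ray_cone v" for u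
      using that above[of "ray_cone u" 0] by (auto simp: P_def)
    ultimately have PZ: "P \<in> Z" using ray_cone_stabilises by blast
    have "C = cone_ray P"
    proof (intro set_eqI iffI)
      fix p assume p: "p \<in> C"
      obtain c m where cm: "p = (c, m)" by (cases p)
      have cT: "(c, m) \<in> cone_tree" using p cm C'(2) by blast
      then have "c \<in> cones" by (simp add: cone_tree_iff)
      then have "P \<in> c"
      proof (cases rule: cones_cases)
        case 1
        then show ?thesis using PZ by simp
      next
        case (2 t)
        then have "t \<in> P" using zero p cm by (auto simp: P_def)
        then show ?thesis using 2 PZ by (simp add: ray_cone_def)
      qed
      then show "p \<in> cone_ray P" using cT cm by (simp add: mem_cone_ray_iff)
    next
      fix p assume "p \<in> cone_ray P"
      then obtain c m where p: "p = (c, m)" "(c, m) \<in> cone_tree" "P \<in> c"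
        by (auto simp: cone_ray_def)
      \<comment> \<open>A strictly smaller cone on \<open>C\<close> lies above every copy of
        \<open>c\<close>, so down-closure puts \<open>(c, m)\<close> in \<open>C\<close> whatever
        \<open>m\<close> is.\<close>
      have "\<exists>d n. (d, n) \<in> C \<and> d \<subset> c"
      proof -
        have "c \<in> cones" using p(2) by (simp add: cone_tree_iff)
        then show ?thesis
        proof (cases rule: cones_cases)
          case 1
          obtain b n where bn: "(b, n) \<in> C" using C'(1) by fastforce
          then have "(b, n) \<in> cone_tree" using C'(2) by blast
          then have "b \<subseteq> Z" using cones_subset by (simp add: cone_tree_iff)
          then show ?thesis using smaller[OF bn] 1 by blast
        next
          case (2 t)
          then have "t \<in> P" using p(3) by (simp add: ray_cone_def)
          then have "(c, 0) \<in> C" using 2 by (simp add: P_def)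
          then show ?thesis using smaller by blast
        qed
      qed
      then show "p \<in> C" using down p(1,2) by blast
    qed
    then show ?thesis using PZ by blast
  qed
qed

lemma cone_tree_rays: "{C. tree_ray cone_tree cone_order C} = cone_ray ` Z"
  using tree_ray_cone_ray cone_tree_ray_cases by blast

section \<open>The homeomorphism with the ray space of the cone tree\<close>

lemma topspace_ray_space_cone_tree:
  "topspace (ray_space cone_tree cone_order) = char_fun cone_tree ` cone_ray ` Z"
  unfolding ray_space_def cone_tree_rays by (auto simp: char_fun_def PiE_iff)

text \<open>Continuity is checked coordinatewise. Coordinate \<open>(b, n)\<close> of
  \<open>f\<close> is constant on the subspace if \<open>b = Z\<close>, and equals coordinate
  \<open>t\<close> if \<open>b = ray_cone t\<close>; it does not depend on \<open>n\<close>.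
  Coordinate \<open>t\<close> of \<open>g\<close> is constant or reads off coordinate
  \<open>(ray_cone t, 0)\<close>.\<close>

lemma homeomorphic_cone_tree:
  "subtopology (ray_space T r) (char_fun T ` Z) homeomorphic_space ray_space cone_tree cone_order"
proof -
  let ?X = "subtopology (ray_space T r) (char_fun T ` Z)"
  let ?Y = "ray_space cone_tree cone_order"
  let ?D = "discrete_topology (UNIV :: bool set)"
  have X: "?X = subtopology (product_topology (\<lambda>_. ?D) T) (char_fun T ` Z)"
  proof -
    have "{P. tree_ray T r P} \<inter> Z = Z" using rays by blast
    moreover have "char_fun T ` {P. tree_ray T r P} \<inter> char_fun T ` Z = char_fun T ` Z"
      using rays by blast
    ultimately show ?thesis by (simp add: ray_space_def subtopology_subtopology)
  qed
  have topX: "topspace ?X = char_fun T ` Z"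
    unfolding X by (auto simp: char_fun_def PiE_iff)
  have topY: "topspace ?Y = char_fun cone_tree ` cone_ray ` Z"
    by (fact topspace_ray_space_cone_tree)
  define f where "f y = char_fun cone_tree (cone_ray {t \<in> T. y t})" for y :: "'a \<Rightarrow> bool"
  \<comment> \<open>Copy \<open>0\<close> exists for every cone. The guard gives the value
    \<open>False\<close> when no ray of \<open>Z\<close> meets \<open>t\<close>, where
    \<open>(ray_cone t, 0)\<close> need not be a node.\<close>
  define g where "g z = (\<lambda>t\<in>T. ray_cone t \<noteq> {} \<and> z (ray_cone t, 0::nat))"
    for z :: "'a set set \<times> nat \<Rightarrow> bool"
  have f: "f (char_fun T P) = char_fun cone_tree (cone_ray P)" if "P \<in> Z" for P
  proof -
    have "{t \<in> T. char_fun T P t} = P"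
      using tree_rayD(2)[OF rays[OF that]] by (auto simp: char_fun_def)
    then show ?thesis by (simp add: f_def)
  qed
  have g: "g (char_fun cone_tree (cone_ray P)) = char_fun T P" if "P \<in> Z" for P
  proof
    fix t
    have "ray_cone t \<noteq> {} \<and> (ray_cone t, 0) \<in> cone_ray P \<longleftrightarrow> t \<in> P" if "t \<in> T"
      using that \<open>P \<in> Z\<close> by (auto simp: mem_cone_ray_iff cone_tree_iff cones_def ray_cone_def)
    moreover have "(ray_cone t, 0) \<in> cone_tree" if "t \<in> T" "ray_cone t \<noteq> {}"
      using that by (auto simp: cone_tree_iff cones_def)
    ultimately show "g (char_fun cone_tree (cone_ray P)) t = char_fun T P t"
      by (auto simp: g_def char_fun_def)
  qed
  have coordX: "continuous_map ?X ?D (\<lambda>y. y t)" if "t \<in> T" for t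
    unfolding X using that
    by (intro continuous_map_from_subtopology continuous_map_product_projection)
  have coordY: "continuous_map ?Y ?D (\<lambda>z. z p)" if "p \<in> cone_tree" for p
    unfolding ray_space_def using that
    by (intro continuous_map_from_subtopology continuous_map_product_projection)
  have "continuous_map ?X ?D (\<lambda>y. f y p)" if "p \<in> cone_tree" for p
  proof -
    obtain b n where p: "p = (b, n)" by (cases p)
    with that have bn: "(b, n) \<in> cone_tree" by simp
    have val: "f (char_fun T P) (b, n) \<longleftrightarrow> P \<in> b" if "P \<in> Z" for P
      using f[OF that] bn by (simp add: char_fun_def mem_cone_ray_iff)
    have "b \<in> cones" using bn by (simp add: cone_tree_iff)
    then show ?thesis
    proof (cases rule: cones_cases)
      case 1
      then have eq: "True = f y p" if "y \<in> topspace ?X" for y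
        using that val p unfolding topX by auto
      have "continuous_map ?X ?D (\<lambda>_. True)" by simp
      then show ?thesis by (rule continuous_map_eq) (fact eq)
    next
      case (2 t)
      then have eq: "y t = f y p" if "y \<in> topspace ?X" for y
        using that val p unfolding topX by (auto simp: char_fun_def ray_cone_def)
      show ?thesis using coordX[OF 2(1)] by (rule continuous_map_eq) (fact eq)
    qed
  qed
  then have "continuous_map ?X (product_topology (\<lambda>_. ?D) cone_tree) f"
    by (rule continuous_map_coordinatewise_then_product) (simp_all add: f_def char_fun_def)
  then have "continuous_map ?X ?Y f"
    using f unfolding ray_space_def[of cone_tree] cone_tree_rays continuous_map_in_subtopology topX
    by auto
  moreover have "continuous_map ?Y ?D (\<lambda>z. g z t)" if t: "t \<in> T" for t
  proof (cases "ray_cone t = {}")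
    case True
    then show ?thesis using t by (simp add: g_def)
  next
    case False
    then have "(ray_cone t, 0) \<in> cone_tree" using t by (auto simp: cone_tree_iff cones_def)
    then show ?thesis using t False coordY by (simp add: g_def)
  qed
  then have "continuous_map ?Y (product_topology (\<lambda>_. ?D) T) g"
    by (rule continuous_map_coordinatewise_then_product) (simp_all add: g_def)
  then have "continuous_map ?Y ?X g"
    using g unfolding X continuous_map_in_subtopology topY by auto
  ultimately have "homeomorphic_maps ?X ?Y f g"
    using f g by (auto simp: homeomorphic_maps_def topX topY)
  then show ?thesis unfolding homeomorphic_space_def by blast
qed

end

section \<open>From closed subspaces to closed sets of rays\<close>

text \<open>A point outside a closed set has a basic open box around it missing that set. The box
  restricts finitely many coordinates, and these form \<open>F\<close>: a ray of \<open>Z\<close>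
  agreeing with \<open>P\<close> on them would lie in the box.\<close>

lemma closedin_ray_space_closed_ray_set:
  assumes "tree_on T r" "closedin (ray_space T r) Y"
  defines "Z \<equiv> {P. tree_ray T r P \<and> char_fun T P \<in> Y}"
  shows "closed_ray_set T r Z" "char_fun T ` Z = Y"
proof -
  let ?X = "product_topology (\<lambda>_. discrete_topology (UNIV :: bool set)) T"
  let ?R = "char_fun T ` {P. tree_ray T r P}"
  obtain K where K: "closedin ?X K" "Y = K \<inter> ?R"
    using assms(2) unfolding ray_space_def closedin_subtopology by blast
  show "char_fun T ` Z = Y" using K(2) unfolding Z_def by blast
  show "closed_ray_set T r Z"
  proof
    fix P assume P: "tree_ray T r P" "P \<notin> Z"
    have PK: "char_fun T P \<in> topspace ?X - K"
      using P K(2) by (auto simp: Z_def char_fun_def)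
    have "openin ?X (topspace ?X - K)" using K(1) by (simp add: closedin_def)
    from bspec[OF iffD1[OF openin_product_topology_alt this] PK]
    obtain U where U: "finite {i \<in> T. U i \<noteq> UNIV}" "char_fun T P \<in> Pi\<^sub>E T U"
      "Pi\<^sub>E T U \<subseteq> topspace ?X - K"
      unfolding topspace_discrete_topology by blast
    let ?F = "{i \<in> T. U i \<noteq> UNIV}"
    have "\<exists>s\<in>?F. s \<in> P \<longleftrightarrow> s \<notin> Q" if Q: "Q \<in> Z" for Q
    proof (rule ccontr)
      assume eq: "\<not> ?thesis"
      have "char_fun T Q \<in> Pi\<^sub>E T U"
      proof (rule PiE_I)
        fix i assume i: "i \<in> T"
        show "char_fun T Q i \<in> U i"
        proof (cases "U i = UNIV")
          case False
          then have "i \<in> Q \<longleftrightarrow> i \<in> P" using eq i by blast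
          then show ?thesis using PiE_mem[OF U(2) i] i by (simp add: char_fun_def)
        qed simp
      qed (simp add: char_fun_def)
      then show False using U(3) Q K(2) by (auto simp: Z_def)
    qed
    then show "\<exists>F\<subseteq>T. finite F \<and> (\<forall>Q\<in>Z. \<exists>s\<in>F. s \<in> P \<longleftrightarrow> s \<notin> Q)"
      using U(1) by (intro exI[of _ ?F]) blast
  qed (use assms(1) in \<open>auto simp: Z_def\<close>)
qed

theorem corollary3p7:
  fixes T :: "'a set" and r :: "'a rel" and Y :: "('a \<Rightarrow> bool) set"
  assumes "tree_on T r"
    and "closedin (ray_space T r) Y"
  shows "\<exists>(T' :: ('a set set \<times> nat) set) (r' :: ('a set set \<times> nat) rel).
           tree_on T' r' \<and>
           subtopology (ray_space T r) Y homeomorphic_space ray_space T' r'"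
proof -
  \<comment> \<open>The cone construction works with rays as sets, so \<open>Y\<close> is pulled
    back along \<open>char_fun T\<close>.\<close>
  define Z where "Z = {P. tree_ray T r P \<and> char_fun T P \<in> Y}"
  interpret closed_ray_set T r Z
    unfolding Z_def by (rule closedin_ray_space_closed_ray_set(1)[OF assms])
  have "char_fun T ` Z = Y"
    unfolding Z_def by (rule closedin_ray_space_closed_ray_set(2)[OF assms])
  then show ?thesis
    using tree_cone_tree homeomorphic_cone_tree by metis
qed

end
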